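(* Let $\lambda:[0,\infty)\to[0,\infty)$ be continuous with $\int_0^t\lambda(s)\,ds<\infty$ for all $t\ge0$, let $X$ be a real random variable and $M(t)=\sum_{k=1}^{N(t)}X_k$, $M\sim CP(\lambda,X)$, with $N$ not exploding in finite intervals. Fix $t>0$ with $\int_0^t\lambda(u)\,du>0$ and let $\Lambda_{t,1},\Lambda_{t,2},\dots$ be i.i.d., independent of $N$ and of $X_1,X_2,\dots$, with $P\{\Lambda_{t,1}\in ds\}=\lambda(s)\,ds/\int_0^t\lambda(u)\,du$, $s\in[0,t]$. Then for every $n\in\mathbb{N}$, $$\int_0^tds_1\int_0^{s_1}ds_2\cdots\int_0^{s_{n-1}}M(s_n)\,ds_n=\frac{1}{(n-1)!}\int_0^tM(s)(t-s)^{n-1}\,ds\ \stackrel{d}{=}\ \frac{t^n}{n!}\sum_{k=1}^{N(t)}X_k\Big(1-\frac{\Lambda_{t,k}}{t}\Big)^n,$$ and the last quantity converges to $0$ in probability as $n\to\infty$.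
   Context: $M\sim CP(\lambda,X)$ means $M(t)=\sum_{k=1}^{N(t)}X_k$, $t\ge0$, with $N$ a (non-homogeneous) Poisson process with rate function $\lambda$ and $X_1,X_2,\dots$ i.i.d. copies of $X$, independent of $N$. The symbol $\stackrel{d}{=}$ denotes equality in distribution of random variables. *)

theory Defs
  imports "HOL-Probability.Probability"
begin

text \<open>
  Time ranges over \<open>{0..}\<close>; values of a process or rate at negative arguments play no role.
  Taking values in \<^typ>\<open>nat\<close>, together with monotonicity, is non-explosion: there are only
  finitely many jumps in every bounded interval. The Poisson probabilities are written out
  because the library's \<open>poisson_pmf\<close> is only specified for a positive rate, while the mean of an
  increment may be 0 here (with \<open>0 ^ 0 = 1\<close> this gives the point mass at 0).
\<close>

locale nonhomogeneous_poisson_process = prob_space P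
  for P :: "'a measure" +
  fixes rate :: "real \<Rightarrow> real" and N :: "real \<Rightarrow> 'a \<Rightarrow> nat"
  assumes rate_nonneg: "\<And>s. 0 \<le> s \<Longrightarrow> 0 \<le> rate s"
    and rate_integrable: "\<And>s. 0 \<le> s \<Longrightarrow> set_integrable lborel {0..s} rate"
    and N_measurable: "\<And>s. 0 \<le> s \<Longrightarrow> N s \<in> P \<rightarrow>\<^sub>M count_space UNIV"
    and N_zero: "\<And>\<omega>. \<omega> \<in> space P \<Longrightarrow> N 0 \<omega> = 0"
    and N_mono: "\<And>\<omega>. \<omega> \<in> space P \<Longrightarrow> mono_on {0..} (\<lambda>s. N s \<omega>)"
    and N_right_continuous:
      "\<And>\<omega> s. \<omega> \<in> space P \<Longrightarrow> 0 \<le> s \<Longrightarrow> continuous (at_right s) (\<lambda>u. N u \<omega>)"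
    and N_indep_increments:
      "\<And>\<tau> m. 0 \<le> \<tau> 0 \<Longrightarrow> incseq \<tau> \<Longrightarrow>
        indep_vars (\<lambda>_. count_space UNIV) (\<lambda>i \<omega>. N (\<tau> (Suc i)) \<omega> - N (\<tau> i) \<omega>) {..<m :: nat}"
    and N_increments_poisson:
      "\<And>a b k. 0 \<le> a \<Longrightarrow> a \<le> b \<Longrightarrow>
        prob {\<omega> \<in> space P. N b \<omega> - N a \<omega> = k}
          = (LINT u:{a..b}|lborel. rate u) ^ k / fact k * exp (- (LINT u:{a..b}|lborel. rate u))"

text \<open>
  \<open>N\<close> and \<open>Xs\<close> viewed as random elements of product spaces, so that independence below refers to
  the whole process and the whole sequence. Sequences are indexed from 1.
\<close>

definition process_path :: "(real \<Rightarrow> 'a \<Rightarrow> 'b) \<Rightarrow> 'a \<Rightarrow> real \<Rightarrow> 'b"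
  where "process_path N \<omega> = (\<lambda>s\<in>{0..}. N s \<omega>)"

definition seq_path :: "(nat \<Rightarrow> 'a \<Rightarrow> 'b) \<Rightarrow> 'a \<Rightarrow> nat \<Rightarrow> 'b"
  where "seq_path Xs \<omega> = (\<lambda>k\<in>{1..}. Xs k \<omega>)"

abbreviation nat_process_space :: "(real \<Rightarrow> nat) measure"
  where "nat_process_space \<equiv> PiM {0..} (\<lambda>_. count_space UNIV)"

abbreviation real_seq_space :: "(nat \<Rightarrow> real) measure"
  where "real_seq_space \<equiv> PiM {1..} (\<lambda>_. borel)"

text \<open>
  Independence of two random elements of possibly different types (the library's \<open>indep_var\<close>
  requires both to have the same type).
\<close>

definition (in prob_space) indep_elements ::
  "'b measure \<Rightarrow> ('a \<Rightarrow> 'b) \<Rightarrow> 'c measure \<Rightarrow> ('a \<Rightarrow> 'c) \<Rightarrow> bool" where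
  "indep_elements S Y T Z \<longleftrightarrow>
    Y \<in> M \<rightarrow>\<^sub>M S \<and> Z \<in> M \<rightarrow>\<^sub>M T \<and>
    indep_set {Y -` A \<inter> space M | A. A \<in> sets S} {Z -` B \<inter> space M | B. B \<in> sets T}"

text \<open>
  \<open>M \<sim> CP(rate, X)\<close>. Only the law of \<open>X\<close> matters, so \<open>X\<close> may live on a probability space \<open>Q\<close> of
  its own.
\<close>

locale compound_poisson_process =
  nonhomogeneous_poisson_process P rate N + X: prob_space Q
  for P :: "'a measure" and rate :: "real \<Rightarrow> real" and N :: "real \<Rightarrow> 'a \<Rightarrow> nat"
    and Q :: "'b measure" +
  fixes X :: "'b \<Rightarrow> real" and Xs :: "nat \<Rightarrow> 'a \<Rightarrow> real" and M :: "real \<Rightarrow> 'a \<Rightarrow> real"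
  assumes X_measurable: "X \<in> borel_measurable Q"
    and Xs_indep: "indep_vars (\<lambda>_. borel) Xs {1..}"
    and Xs_copies: "\<And>k. 1 \<le> k \<Longrightarrow> distr P borel (Xs k) = distr Q borel X"
    and N_Xs_indep:
      "indep_elements nat_process_space (process_path N) real_seq_space (seq_path Xs)"
    and M_eq: "\<And>s \<omega>. 0 \<le> s \<Longrightarrow> \<omega> \<in> space P \<Longrightarrow> M s \<omega> = (\<Sum>k=1..N s \<omega>. Xs k \<omega>)"

text \<open>
  \<open>iterated_integral n f t\<close> is the \<open>n\<close>-fold integral of \<open>f s\<^sub>n\<close> over
  \<open>0 \<le> s\<^sub>n \<le> \<dots> \<le> s\<^sub>1 \<le> t\<close>, with \<open>s\<^sub>1\<close> outermost.
\<close>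

primrec iterated_integral :: "nat \<Rightarrow> (real \<Rightarrow> real) \<Rightarrow> real \<Rightarrow> real" where
  "iterated_integral 0 f t = f t"
| "iterated_integral (Suc n) f t = (LINT s:{0..t}|lborel. iterated_integral n f s)"

text \<open>Measurability is included, since \<^const>\<open>distr\<close> is meaningless without it.\<close>

definition eq_in_distribution :: "'a measure \<Rightarrow> ('a \<Rightarrow> real) \<Rightarrow> ('a \<Rightarrow> real) \<Rightarrow> bool" where
  "eq_in_distribution P Y Z \<longleftrightarrow>
    Y \<in> borel_measurable P \<and> Z \<in> borel_measurable P \<and> distr P borel Y = distr P borel Z"

definition converges_in_probability ::
  "'a measure \<Rightarrow> (nat \<Rightarrow> 'a \<Rightarrow> real) \<Rightarrow> ('a \<Rightarrow> real) \<Rightarrow> bool" where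
  "converges_in_probability P Z Y \<longleftrightarrow>
    (\<forall>\<epsilon>>0. (\<lambda>n. measure P {\<omega> \<in> space P. \<bar>Z n \<omega> - Y \<omega>\<bar> > \<epsilon>}) \<longlonglongrightarrow> 0)"

end

theory Submission
  imports Defs
begin

text \<open>
  If \<open>T\<^sub>k\<close> is the \<open>k\<close>-th jump time of \<open>N\<close>, then \<open>M s\<close> is the sum over \<open>k \<le> N t\<close> of \<open>X\<^sub>k\<close> times the indicator
  of \<open>T\<^sub>k \<le> s\<close>, so both integrals of \<open>M\<close> equal the sum over \<open>k \<le> N t\<close> of \<open>X\<^sub>k g(T\<^sub>k)\<close> with
  \<open>g s = (t - s) ^ n / fact n\<close>. Rather than deriving the conditional law of the jump times given
  \<open>N t\<close>, one compares characteristic functions: with \<open>\<phi>\<close> that of \<open>X\<close>, both this sum and the one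
  with \<open>\<Lambda>\<^sub>k\<close> in place of \<open>T\<^sub>k\<close> have characteristic function
  \<open>exp (\<integral>\<^bsub>0\<^esub>\<^bsup>t\<^esup> (\<phi>(\<theta> g s) - 1) rate s ds)\<close> at \<open>\<theta>\<close>. For the jump times, round them down to a
  grid, so that only finitely many independent Poisson increments are involved, and refine the grid.
  The convergence to 0 even holds pointwise, because \<open>c ^ n / fact n\<close> tends to 0.
\<close>

section \<open>Independence and expectations of products\<close>

text \<open>Rectangles determine a product of \<sigma>-finite measures, and on a rectangle
  independence is the product formula.\<close>

lemma (in prob_space) indep_elements_distr:
  assumes "indep_elements S Y T Z"
  shows "distr M S Y \<Otimes>\<^sub>M distr M T Z = distr M (S \<Otimes>\<^sub>M T) (\<lambda>\<omega>. (Y \<omega>, Z \<omega>))"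
proof (rule pair_measure_eqI)
  have Y[measurable]: "Y \<in> M \<rightarrow>\<^sub>M S" and Z[measurable]: "Z \<in> M \<rightarrow>\<^sub>M T"
    and ind: "indep_set {Y -` A \<inter> space M | A. A \<in> sets S} {Z -` B \<inter> space M | B. B \<in> sets T}"
    using assms by (auto simp: indep_elements_def)
  show "sigma_finite_measure (distr M S Y)" "sigma_finite_measure (distr M T Z)"
    by (auto intro!: prob_space_imp_sigma_finite prob_space_distr)
  show "sets (distr M S Y \<Otimes>\<^sub>M distr M T Z) = sets (distr M (S \<Otimes>\<^sub>M T) (\<lambda>\<omega>. (Y \<omega>, Z \<omega>)))"
    by (simp cong: sets_pair_measure_cong)
  fix A B assume "A \<in> sets (distr M S Y)" "B \<in> sets (distr M T Z)"
  then have [measurable]: "A \<in> sets S" "B \<in> sets T" by auto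
  have "prob ((Y -` A \<inter> space M) \<inter> (Z -` B \<inter> space M)) = prob (Y -` A \<inter> space M) * prob (Z -` B \<inter> space M)"
    by (rule indep_setD[OF ind]) auto
  moreover have "(\<lambda>\<omega>. (Y \<omega>, Z \<omega>)) -` (A \<times> B) \<inter> space M = (Y -` A \<inter> space M) \<inter> (Z -` B \<inter> space M)"
    by auto
  ultimately show "emeasure (distr M S Y) A * emeasure (distr M T Z) B
      = emeasure (distr M (S \<Otimes>\<^sub>M T) (\<lambda>\<omega>. (Y \<omega>, Z \<omega>))) (A \<times> B)"
    by (simp add: emeasure_distr emeasure_eq_measure ennreal_mult)
qed

text \<open>Fubini for the joint law, with boundedness providing integrability. It takes the place
  of conditioning: \<open>Y\<close> is frozen at \<open>\<omega>\<close> while \<open>Z\<close> is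
  averaged over a separate outcome \<open>\<omega>'\<close>.\<close>

lemma (in prob_space) indep_elements_expectation:
  fixes F :: "'b \<times> 'c \<Rightarrow> 'd::{banach, second_countable_topology}"
  assumes ind: "indep_elements S Y T Z" and F[measurable]: "F \<in> borel_measurable (S \<Otimes>\<^sub>M T)"
    and bd: "\<And>p. norm (F p) \<le> B"
  shows "expectation (\<lambda>\<omega>. F (Y \<omega>, Z \<omega>)) = expectation (\<lambda>\<omega>. expectation (\<lambda>\<omega>'. F (Y \<omega>, Z \<omega>')))"
proof -
  have Y[measurable]: "Y \<in> M \<rightarrow>\<^sub>M S" and Z[measurable]: "Z \<in> M \<rightarrow>\<^sub>M T"
    using ind by (auto simp: indep_elements_def)
  interpret Y: prob_space "distr M S Y" by (rule prob_space_distr) simp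
  interpret Z: prob_space "distr M T Z" by (rule prob_space_distr) simp
  interpret YZ: pair_prob_space "distr M S Y" "distr M T Z" ..
  have "expectation (\<lambda>\<omega>. F (Y \<omega>, Z \<omega>)) = integral\<^sup>L (distr M (S \<Otimes>\<^sub>M T) (\<lambda>\<omega>. (Y \<omega>, Z \<omega>))) F"
    by (subst integral_distr) auto
  also have "\<dots> = (\<integral>y. (\<integral>z. F (y, z) \<partial>distr M T Z) \<partial>distr M S Y)"
    unfolding indep_elements_distr[OF ind, symmetric]
    by (rule YZ.integral_fst'[symmetric], rule YZ.P.integrable_const_bound[where B=B]) (auto simp: bd)
  also have "\<dots> = (\<integral>y. expectation (\<lambda>\<omega>'. F (y, Z \<omega>')) \<partial>distr M S Y)"
    by (rule Bochner_Integration.integral_cong[OF refl]) (subst integral_distr, auto)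
  also have "\<dots> = expectation (\<lambda>\<omega>. expectation (\<lambda>\<omega>'. F (Y \<omega>, Z \<omega>')))"
    by (rule integral_distr) measurable
  finally show ?thesis .
qed

text \<open>The test functions \<open>f k\<close> may vary with \<open>k\<close> although the
  variables share one law, because later the k-th factor carries its own weight.\<close>

lemma (in prob_space) expectation_prod_identically_distributed:
  fixes f :: "'i \<Rightarrow> real \<Rightarrow> complex"
  assumes ind: "indep_vars (\<lambda>_. borel) V I" and D: "\<And>k. k \<in> I \<Longrightarrow> distr M borel (V k) = D"
    and J: "finite J" "J \<subseteq> I"
    and f[measurable]: "\<And>k. f k \<in> borel_measurable borel" and bd: "\<And>k x. norm (f k x) \<le> 1"
  shows "expectation (\<lambda>\<omega>. \<Prod>k\<in>J. f k (V k \<omega>)) = (\<Prod>k\<in>J. \<integral>x. f k x \<partial>D)"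
proof -
  have V[measurable]: "k \<in> J \<Longrightarrow> V k \<in> borel_measurable M" for k
    using ind J by (auto simp: indep_vars_def)
  have "expectation (\<lambda>\<omega>. \<Prod>k\<in>J. f k (V k \<omega>)) = (\<Prod>k\<in>J. expectation (\<lambda>\<omega>. f k (V k \<omega>)))"
  proof (rule indep_vars_lebesgue_integral[OF J(1)])
    show "indep_vars (\<lambda>_. borel) (\<lambda>k \<omega>. f k (V k \<omega>)) J"
      by (rule indep_vars_compose2[OF indep_vars_subset[OF ind J(2)]]) simp
    show "integrable M (\<lambda>\<omega>. f k (V k \<omega>))" if "k \<in> J" for k
      using that by (intro integrable_const_bound[where B=1]) (auto simp: bd)
  qed
  also have "\<dots> = (\<Prod>k\<in>J. \<integral>x. f k x \<partial>D)"
  proof (rule prod.cong[OF refl])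
    fix k assume k: "k \<in> J"
    then have "D = distr M borel (V k)" using D J by auto
    with k show "expectation (\<lambda>\<omega>. f k (V k \<omega>)) = (\<integral>x. f k x \<partial>D)"
      by (simp add: integral_distr)
  qed
  finally show ?thesis .
qed

section \<open>Poisson increments and jump times\<close>

context nonhomogeneous_poisson_process
begin

definition mean :: "real \<Rightarrow> real \<Rightarrow> real" where
  "mean a b = (LINT u:{a..b}|lborel. rate u)"

text \<open>This is the probability generating function of the Poisson law, taken on the closed
  complex unit disc because \<open>z\<close> will be a value of a characteristic function or an
  average of such values.\<close>

lemma expectation_power_increment:
  fixes z :: complex
  assumes ab: "0 \<le> a" "a \<le> b" and z: "norm z \<le> 1"
  shows "expectation (\<lambda>\<omega>. z ^ (N b \<omega> - N a \<omega>)) = exp (mean a b * (z - 1))"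
proof -
  define K where "K = (\<lambda>\<omega>. N b \<omega> - N a \<omega>)"
  define p where "p k = mean a b ^ k / fact k * exp (- mean a b)" for k
  have [measurable]: "N a \<in> P \<rightarrow>\<^sub>M count_space UNIV" "N b \<in> P \<rightarrow>\<^sub>M count_space UNIV"
    using ab by (auto intro: N_measurable)
  have K[measurable]: "K \<in> P \<rightarrow>\<^sub>M count_space UNIV" unfolding K_def by measurable
  have pk: "prob {\<omega> \<in> space P. K \<omega> = k} = p k" for k
    using N_increments_poisson[OF ab, of k] by (simp add: K_def p_def mean_def)
  have p0: "p k \<ge> 0" for k unfolding pk[symmetric] by simp
  \<comment> \<open>A density with respect to counting measure turns the expectation into a power
    series. The case \<open>mean a b = 0\<close> is covered.\<close>
  have distr: "distr P (count_space UNIV) K = density (count_space UNIV) p"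
  proof (rule measure_eqI_countable[of _ UNIV])
    fix k :: nat
    have "emeasure (distr P (count_space UNIV) K) {k} = ennreal (p k)"
      unfolding pk[symmetric]
      by (subst emeasure_distr) (auto simp: emeasure_eq_measure vimage_def Int_def conj_commute)
    then show "emeasure (distr P (count_space UNIV) K) {k} = emeasure (density (count_space UNIV) p) {k}"
      by (simp add: emeasure_density nn_integral_count_space_indicator[symmetric])
  qed auto
  have s: "(\<lambda>k. p k *\<^sub>R z ^ k) sums (exp (mean a b * z) * exp (- mean a b))"
    using sums_mult2[OF exp_converges[of "mean a b * z"], of "of_real (exp (- mean a b))"]
    by (simp add: p_def scaleR_conv_of_real power_mult_distrib mult_ac divide_inverse of_real_exp[symmetric])
  have "summable (\<lambda>k. norm (p k *\<^sub>R z ^ k))"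
  proof (rule summable_comparison_test'[where N=0])
    show "summable p"
      using summable_mult2[OF summable_exp[of "mean a b"], of "exp (- mean a b)"]
      by (simp add: p_def[abs_def] divide_inverse mult_ac)
    show "norm (norm (p k *\<^sub>R z ^ k)) \<le> p k" for k
      using mult_left_mono[OF power_le_one[OF norm_ge_zero z] p0]
      by (simp add: norm_power p0)
  qed
  then have int: "integrable (count_space UNIV) (\<lambda>k. p k *\<^sub>R z ^ k)"
    by (simp add: integrable_count_space_nat_iff)
  have "expectation (\<lambda>\<omega>. z ^ K \<omega>) = (\<integral>k. z ^ k \<partial>distr P (count_space UNIV) K)"
    by (subst integral_distr) auto
  also have "\<dots> = (\<integral>k. p k *\<^sub>R z ^ k \<partial>count_space UNIV)"
    unfolding distr by (subst integral_density) (auto simp: p0)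
  also have "\<dots> = exp (mean a b * z) * exp (- mean a b)"
    using s by (simp add: integral_count_space_nat[OF int] sums_iff)
  also have "\<dots> = exp (mean a b * (z - 1))"
    by (simp add: exp_add[symmetric] algebra_simps exp_of_real[symmetric])
  finally show ?thesis by (simp add: K_def)
qed

text \<open>Meaningful only if \<open>k \<le> N t \<omega>\<close> for some \<open>t \<ge> 0\<close>; otherwise this is the infimum of the empty set.\<close>

definition arrival :: "nat \<Rightarrow> 'a \<Rightarrow> real" where
  "arrival k \<omega> = Inf {s. 0 \<le> s \<and> k \<le> N s \<omega>}"

text \<open>Right-continuity together with integer values makes the path constant just to the right
  of \<open>arrival k \<omega>\<close>, so the infimum is attained; monotonicity gives the rest. The
  hypothesis \<open>k \<le> N t \<omega>\<close> makes the set of times nonempty.\<close>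

lemma arrival_le_iff:
  assumes \<omega>: "\<omega> \<in> space P" and t: "0 \<le> t" "k \<le> N t \<omega>" and s: "0 \<le> s"
  shows "arrival k \<omega> \<le> s \<longleftrightarrow> k \<le> N s \<omega>"
proof -
  let ?S = "{s. 0 \<le> s \<and> k \<le> N s \<omega>}"
  have ne: "?S \<noteq> {}" and bdd: "bdd_below ?S" using t by auto
  have T0: "0 \<le> arrival k \<omega>"
    unfolding arrival_def by (rule cInf_greatest[OF ne]) auto
  have mono: "N u \<omega> \<le> N v \<omega>" if "0 \<le> u" "u \<le> v" for u v
    using N_mono[OF \<omega>] that by (auto simp: mono_on_def)
  have above: "k \<le> N u \<omega>" if "arrival k \<omega> < u" for u
  proof -
    from that obtain v where "v \<in> ?S" "v < u"
      unfolding arrival_def using cInf_less_iff[OF ne bdd] by auto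
    then show ?thesis using mono[of v u] by auto
  qed
  have "((\<lambda>u. N u \<omega>) \<longlongrightarrow> N (arrival k \<omega>) \<omega>) (at_right (arrival k \<omega>))"
    using N_right_continuous[OF \<omega> T0] by (simp add: continuous_within)
  then have "\<forall>\<^sub>F u in at_right (arrival k \<omega>). N u \<omega> = N (arrival k \<omega>) \<omega>"
    by (simp add: tendsto_discrete)
  moreover have "\<forall>\<^sub>F u in at_right (arrival k \<omega>). k \<le> N u \<omega>"
    by (rule eventually_at_right_less[THEN eventually_mono]) (rule above)
  \<comment> \<open>The property no longer mentions \<open>u\<close>, and right neighbourhoods form
    a nontrivial filter, so it holds outright.\<close>
  ultimately have "\<forall>\<^sub>F u in at_right (arrival k \<omega>). k \<le> N (arrival k \<omega>) \<omega>"
    by eventually_elim simp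
  then have "k \<le> N (arrival k \<omega>) \<omega>" by simp
  then show ?thesis
    using mono[OF T0, of s] cInf_lower[OF _ bdd, of s] s by (auto simp: arrival_def)
qed

text \<open>Strict positivity matters because the grid cells below are open on the left and so miss
  time 0.\<close>

lemma arrival_pos:
  assumes "\<omega> \<in> space P" "0 \<le> t" "k \<le> N t \<omega>" "1 \<le> k"
  shows "0 < arrival k \<omega>"
  using arrival_le_iff[OF assms(1-3), of 0] N_zero[OF assms(1)] assms(4) by auto

end

section \<open>Rounding down to a grid\<close>

definition grid :: "real \<Rightarrow> nat \<Rightarrow> nat \<Rightarrow> real" where
  "grid t m i = t * real i / real (Suc m)"

lemma grid_nonneg: "0 \<le> t \<Longrightarrow> 0 \<le> grid t m i"
  by (simp add: grid_def)

lemma grid_incseq: "0 \<le> t \<Longrightarrow> incseq (grid t m)"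
  by (auto simp: grid_def incseq_def intro!: divide_right_mono mult_left_mono)

lemma grid_0: "grid t m 0 = 0" and grid_last: "grid t m (Suc m) = t"
  by (auto simp: grid_def simp del: of_nat_Suc)

text \<open>Cells are open on the left and closed on the right because the k-th jump time lies in
  \<open>{a<..b}\<close> exactly when \<open>N a < k \<le> N b\<close>. For \<open>t > 0\<close> the
  function vanishes off \<open>{0<..t}\<close>.\<close>

definition grid_step :: "real \<Rightarrow> nat \<Rightarrow> (real \<Rightarrow> 'b::real_vector) \<Rightarrow> real \<Rightarrow> 'b" where
  "grid_step t m h s = (\<Sum>i<Suc m. indicat_real {grid t m i<..grid t m (Suc i)} s *\<^sub>R h (grid t m i))"

text \<open>The cell index is found from \<open>s\<close> alone, so one \<open>i\<close> serves
  every \<open>h\<close>.\<close>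

lemma grid_step_eq:
  assumes t: "0 < t" and s: "0 < s" "s \<le> t"
  obtains i where "i < Suc m" "grid t m i < s" "s \<le> grid t m (Suc i)"
    "\<And>h :: real \<Rightarrow> 'b::real_vector. grid_step t m h s = h (grid t m i)"
proof -
  \<comment> \<open>A ceiling minus one rather than a floor, since a grid point belongs to the cell
    that it ends.\<close>
  define i where "i = nat (\<lceil>s * real (Suc m) / t\<rceil> - 1)"
  let ?q = "s * real (Suc m) / t"
  have "s * real (Suc m) \<le> real (Suc m) * t"
    using mult_right_mono[OF s(2), of "real (Suc m)"] by (simp only: mult.commute of_nat_0_le_iff)
  then have q: "0 < ?q" "?q \<le> real (Suc m)"
    using t s by (simp_all only: pos_divide_le_eq) simp
  then have i: "real i < ?q" "?q \<le> real (Suc i)" unfolding i_def by linarith+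
  have iff: "grid t m j < s \<longleftrightarrow> real j < ?q" "s \<le> grid t m j \<longleftrightarrow> ?q \<le> real j" for j
    using t by (auto simp: grid_def field_simps)
  have uniq: "j = i" if "grid t m j < s" "s \<le> grid t m (Suc j)" for j
    using that i unfolding iff by linarith
  have im: "i < Suc m" using i q by linarith
  show thesis
  proof (rule that[OF im])
    show *: "grid t m i < s" "s \<le> grid t m (Suc i)" using i iff by auto
    fix h :: "real \<Rightarrow> 'b"
    have "grid_step t m h s = (\<Sum>j<Suc m. if j = i then h (grid t m j) else 0)"
      unfolding grid_step_def
    proof (intro sum.cong refl)
      fix j
      show "indicat_real {grid t m j<..grid t m (Suc j)} s *\<^sub>R h (grid t m j)
          = (if j = i then h (grid t m j) else 0)"
        using uniq[of j] * by (cases "j = i") (auto simp: indicator_def)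
    qed
    then show "grid_step t m h s = h (grid t m i)" using im by simp
  qed
qed

text \<open>The point at which \<open>h\<close> is sampled lies between \<open>s - t / Suc m\<close>
  and \<open>s\<close>, hence tends to \<open>s\<close>, and \<open>h\<close> is continuous.\<close>

lemma grid_step_tendsto:
  fixes h :: "real \<Rightarrow> 'b::real_normed_vector"
  assumes t: "0 < t" and s: "0 < s" "s \<le> t" and h: "continuous_on UNIV h"
  shows "(\<lambda>m. grid_step t m h s) \<longlonglongrightarrow> h s"
proof -
  have "\<exists>r. grid_step t m h s = h r \<and> s - t / Suc m \<le> r \<and> r \<le> s" for m
  proof -
    obtain i where "grid t m i < s" "s \<le> grid t m (Suc i)" "grid_step t m h s = h (grid t m i)"
      using grid_step_eq[OF t s, where 'b='b] by blast
    moreover have "grid t m (Suc i) = grid t m i + t / Suc m"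
      by (simp add: grid_def add_divide_distrib distrib_left add.commute)
    ultimately show ?thesis
      by (intro exI[of _ "grid t m i"]) auto
  qed
  then obtain r where r: "\<And>m. grid_step t m h s = h (r m)" "\<And>m. s - t / Suc m \<le> r m" "\<And>m. r m \<le> s"
    by metis
  have "(\<lambda>m. s - t / Suc m) \<longlonglongrightarrow> s - 0"
    by (intro tendsto_intros) (use LIMSEQ_inverse_real_of_nat in \<open>auto intro!: tendsto_mult_right_zero simp: divide_inverse\<close>)
  then have "r \<longlonglongrightarrow> s"
    by (intro tendsto_sandwich[of "\<lambda>m. s - t / Suc m" r sequentially "\<lambda>_. s"]) (use r in \<open>auto simp del: of_nat_Suc\<close>)
  then have "(\<lambda>m. h (r m)) \<longlonglongrightarrow> h s"
    by (rule continuous_on_tendsto_compose[OF h]) auto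
  then show ?thesis by (simp only: r(1))
qed

lemma (in prob_space) norm_expectation_le:
  fixes f :: "'a \<Rightarrow> 'b::{banach, second_countable_topology}"
  assumes "f \<in> borel_measurable M" "\<And>x. norm (f x) \<le> B"
  shows "norm (expectation f) \<le> B"
proof -
  have "integrable M f" by (rule integrable_const_bound[where B=B]) (use assms in auto)
  then have "norm (expectation f) \<le> expectation (\<lambda>x. norm (f x))"
    by (intro integral_norm_bound)
  also have "\<dots> \<le> B"
    by (rule integral_le_const) (use \<open>integrable M f\<close> assms in auto)
  finally show ?thesis .
qed

text \<open>The blocks \<open>{a i<..a (Suc i)}\<close> partition \<open>{1..a m}\<close>, and for
  \<open>k\<close> in block \<open>i\<close> only the i-th summand survives. In use,
  \<open>a i\<close> is the value of \<open>N\<close> at the i-th grid point, so grouping jumps by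
  cell produces powers whose exponents are Poisson increments.\<close>

lemma prod_step_function:
  fixes a :: "nat \<Rightarrow> nat" and f :: "real \<Rightarrow> complex"
  assumes a: "incseq a" "a 0 = 0"
  shows "(\<Prod>k=1..a m. f (\<Sum>i<m. if a i < k \<and> k \<le> a (Suc i) then y i else 0))
    = (\<Prod>i<m. f (y i) ^ (a (Suc i) - a i))"
proof -
  have split: "(\<Prod>k=1..a m. G k) = (\<Prod>i<m. \<Prod>k\<in>{a i<..a (Suc i)}. G k)" for G :: "nat \<Rightarrow> complex"
  proof (induction m)
    case (Suc m)
    have "{1..a (Suc m)} = {1..a m} \<union> {a m<..a (Suc m)}"
      using incseqD[OF a(1), of m "Suc m"] by auto
    then have "prod G {1..a (Suc m)} = prod G {1..a m} * prod G {a m<..a (Suc m)}"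
      by (simp only:) (rule prod.union_disjoint, auto)
    then show ?case by (simp add: Suc[symmetric])
  qed (simp add: a)
  have "(\<Sum>j<m. if a j < k \<and> k \<le> a (Suc j) then y j else 0) = y i"
    if "i < m" "k \<in> {a i<..a (Suc i)}" for i k
  proof -
    have "j = i" if "a j < k" "k \<le> a (Suc j)" for j
    proof (rule ccontr)
      assume "j \<noteq> i"
      then have "Suc j \<le> i \<or> Suc i \<le> j" by auto
      then show False
        using incseqD[OF a(1), of "Suc j" i] incseqD[OF a(1), of "Suc i" j] that
          \<open>k \<in> {a i<..a (Suc i)}\<close> by auto
    qed
    then have "(\<Sum>j<m. if a j < k \<and> k \<le> a (Suc j) then y j else 0) = (\<Sum>j<m. if j = i then y j else 0)"
      using that by (intro sum.cong) auto
    then show ?thesis using that by simp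
  qed
  then show ?thesis
    unfolding split by (intro prod.cong) auto
qed

text \<open>The Riemann-Stieltjes sum is exactly the integral of \<open>grid_step t m h\<close>
  against the rate on \<open>{0..t}\<close>, so dominated convergence applies with \<open>C\<close>
  times the rate as bound.\<close>

lemma (in nonhomogeneous_poisson_process) sum_mean_grid_tendsto:
  fixes h :: "real \<Rightarrow> complex"
  assumes t: "0 < t" and h: "continuous_on UNIV h" and bd: "\<And>s. norm (h s) \<le> C"
  shows "(\<lambda>m. \<Sum>i<Suc m. mean (grid t m i) (grid t m (Suc i)) * h (grid t m i))
    \<longlonglongrightarrow> (\<integral>s. (indicator {0..t} s * rate s) *\<^sub>R h s \<partial>lborel)"
proof -
  define f where "f s = indicator {0..t} s * rate s" for s
  have f: "integrable lborel f"
    using rate_integrable[of t] t by (simp add: set_integrable_def f_def[abs_def])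
  have [measurable]: "f \<in> borel_measurable borel" using f by auto
  have [measurable]: "h \<in> borel_measurable borel" by (rule borel_measurable_continuous_onI[OF h])
  have f0: "0 \<le> f s" for s using rate_nonneg by (auto simp: f_def indicator_def)
  \<comment> \<open>Passing to the left-open interval drops a single point, a null set; the bounds
    on \<open>a\<close> and \<open>b\<close> ensure that \<open>f\<close> agrees with
    \<open>rate\<close> there.\<close>
  have m: "mean a b = (\<integral>s. indicator {a<..b} s * f s \<partial>lborel)" if "0 \<le> a" "b \<le> t" for a b
  proof -
    have "mean a b = (\<integral>s. indicator {a..b} s * f s \<partial>lborel)"
      unfolding mean_def set_lebesgue_integral_def f_def
      using that by (intro Bochner_Integration.integral_cong) (auto simp: indicator_def)
    also have "\<dots> = (\<integral>s. indicator {a<..b} s * f s \<partial>lborel)"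
      using AE_lborel_singleton[of a]
      by (intro integral_cong_AE) (auto simp: indicator_def)
    finally show ?thesis .
  qed
  have eq: "(\<Sum>i<Suc n. mean (grid t n i) (grid t n (Suc i)) * h (grid t n i))
      = (\<integral>s. f s *\<^sub>R grid_step t n h s \<partial>lborel)" for n
  proof -
    have i: "integrable lborel (\<lambda>s. indicator {a<..b} s * f s)" for a b
      using integrable_mult_indicator[OF _ f, of "{a<..b}"] by simp
    have "(\<integral>s. f s *\<^sub>R grid_step t n h s \<partial>lborel)
      = (\<integral>s. (\<Sum>i<Suc n. (indicator {grid t n i<..grid t n (Suc i)} s * f s) *\<^sub>R h (grid t n i)) \<partial>lborel)"
      unfolding grid_step_def by (simp only: scaleR_sum_right scaleR_scaleR mult.commute)
    also have "\<dots> = (\<Sum>i<Suc n. (\<integral>s. (indicator {grid t n i<..grid t n (Suc i)} s * f s) *\<^sub>R h (grid t n i) \<partial>lborel))"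
      by (rule Bochner_Integration.integral_sum) (intro integrable_scaleR_left i)
    also have "\<dots> = (\<Sum>i<Suc n. mean (grid t n i) (grid t n (Suc i)) * h (grid t n i))"
    proof (rule sum.cong[OF refl])
      fix i assume "i \<in> {..<Suc n}"
      then have "grid t n (Suc i) \<le> t"
        using incseqD[OF grid_incseq, of t "Suc i" "Suc n" n] t by (simp add: grid_last)
      then show "(\<integral>s. (indicator {grid t n i<..grid t n (Suc i)} s * f s) *\<^sub>R h (grid t n i) \<partial>lborel)
          = mean (grid t n i) (grid t n (Suc i)) * h (grid t n i)"
        using grid_nonneg[of t n i] t
        by (subst integral_scaleR_left[OF i]) (simp add: m scaleR_conv_of_real)
    qed
    finally show ?thesis ..
  qed
  show ?thesis
    unfolding eq f_def[symmetric]
  proof (rule integral_dominated_convergence[where w="\<lambda>s. f s * C"])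
    show "(\<lambda>s. f s *\<^sub>R h s) \<in> borel_measurable lborel" by measurable
    show "(\<lambda>s. f s *\<^sub>R grid_step t n h s) \<in> borel_measurable lborel" for n
      unfolding grid_step_def by measurable
    show "integrable lborel (\<lambda>s. f s * C)" using f by simp
    \<comment> \<open>At \<open>s = 0\<close> the step function vanishes while \<open>h 0\<close>
      need not, so this point is discarded as a null set.\<close>
    have *: "f s = 0 \<or> 0 < s \<and> s \<le> t" if "s \<noteq> 0" for s
      using that by (auto simp: f_def indicator_def)
    show "AE s in lborel. (\<lambda>n. f s *\<^sub>R grid_step t n h s) \<longlonglongrightarrow> f s *\<^sub>R h s"
      using AE_lborel_singleton[of 0]
    proof eventually_elim
      case (elim s)
      with *[of s] grid_step_tendsto[OF t _ _ h, of s] show ?case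
        by (auto intro: tendsto_scaleR)
    qed
    show "AE s in lborel. norm (f s *\<^sub>R grid_step t n h s) \<le> f s * C" for n
      using AE_lborel_singleton[of 0]
    proof eventually_elim
      case (elim s)
      then consider "f s = 0" | "0 < s" "s \<le> t" using * by auto
      then show ?case
      proof cases
        case 2
        then obtain i where "grid_step t n h s = h (grid t n i)"
          using grid_step_eq[OF t, of s, where 'b=complex] by metis
        then show ?thesis using f0[of s] bd by (simp add: mult_left_mono)
      qed simp
    qed
  qed
qed

section \<open>Characteristic function of the sum over jump times\<close>

context compound_poisson_process
begin

abbreviation "step_law \<equiv> distr Q borel X"

lemma real_distribution_step_law: "real_distribution step_law"
  using X_measurable by (simp add: real_distribution_def real_distribution_axioms_def X.prob_space_distr)

lemma Xs_measurable: "1 \<le> k \<Longrightarrow> Xs k \<in> borel_measurable P"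
  using Xs_indep by (auto simp: indep_vars_def)

text \<open>By \<open>arrival_le_iff\<close>, membership of a jump time in a cell can be read off
  \<open>N\<close> at the two end points, so the rounded jump times depend on finitely many values
  of the path.\<close>

lemma arrival_grid_step:
  assumes t: "0 < t" and \<omega>: "\<omega> \<in> space P" and k: "k \<le> N t \<omega>"
  shows "grid_step t m g (arrival k \<omega>)
    = (\<Sum>i<Suc m. if N (grid t m i) \<omega> < k \<and> k \<le> N (grid t m (Suc i)) \<omega> then g (grid t m i) else 0)"
  unfolding grid_step_def
proof (intro sum.cong refl)
  fix i
  have "arrival k \<omega> \<le> grid t m j \<longleftrightarrow> k \<le> N (grid t m j) \<omega>" for j
    using arrival_le_iff[OF \<omega> _ k] grid_nonneg t by auto
  from this[of i] this[of "Suc i"]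
  show "indicat_real {grid t m i<..grid t m (Suc i)} (arrival k \<omega>) *\<^sub>R g (grid t m i)
    = (if N (grid t m i) \<omega> < k \<and> k \<le> N (grid t m (Suc i)) \<omega> then g (grid t m i) else 0)"
    by (auto simp: indicator_def not_less)
qed

text \<open>Given the path of \<open>N\<close>, averaging over the \<open>Xs\<close> gives a product
  over jumps. Grouped by grid cell it becomes a product of powers with the increments of
  \<open>N\<close> as exponents; these are independent, and each factor is a Poisson generating
  function.\<close>

lemma
  fixes g :: "real \<Rightarrow> real"
  assumes t: "0 < t"
  defines "Y \<equiv> \<lambda>m \<omega>. \<Sum>k=1..N t \<omega>. Xs k \<omega> * grid_step t m g (arrival k \<omega>)"
  shows measurable_grid_step_sum: "Y m \<in> borel_measurable P"
    and char_grid_step_sum: "expectation (\<lambda>\<omega>. iexp (\<theta> * Y m \<omega>))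
      = exp (\<Sum>i<Suc m. mean (grid t m i) (grid t m (Suc i)) * (char step_law (\<theta> * g (grid t m i)) - 1))"
proof -
  interpret D: real_distribution step_law by (rule real_distribution_step_law)
  \<comment> \<open>\<open>c \<nu> k\<close> is \<open>g\<close> at the rounded k-th jump, expressed
    through the path \<open>\<nu>\<close> at grid points only. This makes \<open>S\<close>
    measurable on the product space, whereas the infimum in \<open>arrival\<close> ranges over
    uncountably many times.\<close>
  define c where "c \<nu> k = (\<Sum>i<Suc m. if \<nu> (grid t m i) < k \<and> k \<le> \<nu> (grid t m (Suc i)) then g (grid t m i) else 0)"
    for \<nu> :: "real \<Rightarrow> nat" and k
  define S where "S = (\<lambda>(\<nu>, x). \<Sum>k=1..\<nu> t. x k * c \<nu> k)"
  have g0: "0 \<le> grid t m i" for i using t grid_nonneg by auto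
  have NX: "(\<lambda>\<omega>. (process_path N \<omega>, seq_path Xs \<omega>)) \<in> P \<rightarrow>\<^sub>M nat_process_space \<Otimes>\<^sub>M real_seq_space"
    using N_Xs_indep by (intro measurable_Pair) (auto simp: indep_elements_def)
  have S: "S \<in> borel_measurable (nat_process_space \<Otimes>\<^sub>M real_seq_space)"
  proof -
    have [measurable]: "(\<lambda>p. fst p s) \<in> nat_process_space \<Otimes>\<^sub>M real_seq_space \<rightarrow>\<^sub>M count_space UNIV"
      if "0 \<le> s" for s
      using that by (intro measurable_compose[OF measurable_fst] measurable_component_singleton) auto
    have [measurable]: "(\<lambda>p. snd p k) \<in> borel_measurable (nat_process_space \<Otimes>\<^sub>M real_seq_space)"
      if "1 \<le> k" for k
      using that by (intro measurable_compose[OF measurable_snd] measurable_component_singleton) auto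
    have c[measurable]: "(\<lambda>p. c (fst p) k) \<in> borel_measurable (nat_process_space \<Otimes>\<^sub>M real_seq_space)" for k
      unfolding c_def using g0 by measurable
    have "(\<lambda>p. \<Sum>k=1..n. snd p k * c (fst p) k) \<in> borel_measurable (nat_process_space \<Otimes>\<^sub>M real_seq_space)" for n
      by (intro borel_measurable_sum borel_measurable_times c) auto
    \<comment> \<open>The number of summands is random but takes countably many values, so
      measurability for each fixed \<open>n\<close> suffices.\<close>
    then have "(\<lambda>p. \<Sum>k=1..fst p t. snd p k * c (fst p) k) \<in> borel_measurable (nat_process_space \<Otimes>\<^sub>M real_seq_space)"
      by (rule measurable_compose_countable[where g="\<lambda>p. fst p t"]) (simp add: t less_imp_le)
    then show ?thesis by (simp add: S_def case_prod_beta)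
  qed
  have S_path: "S (process_path N \<omega>, seq_path Xs \<omega>') = (\<Sum>k=1..N t \<omega>. Xs k \<omega>' * c (\<lambda>s. N s \<omega>) k)" for \<omega> \<omega>'
    using t g0 by (auto simp: S_def process_path_def seq_path_def c_def intro!: sum.cong)
  have Y: "Y m \<omega> = S (process_path N \<omega>, seq_path Xs \<omega>)" if "\<omega> \<in> space P" for \<omega>
    unfolding Y_def S_path using arrival_grid_step[OF t that, of _ m g]
    by (intro sum.cong) (auto simp: c_def)
  show "Y m \<in> borel_measurable P"
    using measurable_compose[OF NX S] by (simp cong: measurable_cong add: Y)
  let ?\<phi> = "\<lambda>i. char step_law (\<theta> * g (grid t m i))"
  have "expectation (\<lambda>\<omega>. iexp (\<theta> * Y m \<omega>)) = expectation (\<lambda>\<omega>. iexp (\<theta> * S (process_path N \<omega>, seq_path Xs \<omega>)))"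
    by (intro Bochner_Integration.integral_cong) (auto simp: Y)
  also have "\<dots> = expectation (\<lambda>\<omega>. expectation (\<lambda>\<omega>'. iexp (\<theta> * S (process_path N \<omega>, seq_path Xs \<omega>'))))"
    using S by (intro indep_elements_expectation[OF N_Xs_indep, where B=1]) auto
  also have "\<dots> = expectation (\<lambda>\<omega>. \<Prod>i<Suc m. ?\<phi> i ^ (N (grid t m (Suc i)) \<omega> - N (grid t m i) \<omega>))"
  proof (intro Bochner_Integration.integral_cong refl)
    fix \<omega> assume \<omega>: "\<omega> \<in> space P"
    have inc: "incseq (\<lambda>i. N (grid t m i) \<omega>)"
      using N_mono[OF \<omega>] incseqD[OF grid_incseq[of t]] g0 t
      by (auto simp: incseq_def mono_on_def)
    have "expectation (\<lambda>\<omega>'. iexp (\<theta> * S (process_path N \<omega>, seq_path Xs \<omega>')))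
        = expectation (\<lambda>\<omega>'. \<Prod>k=1..N t \<omega>. iexp (\<theta> * c (\<lambda>s. N s \<omega>) k * Xs k \<omega>'))"
      unfolding S_path by (simp add: exp_sum[symmetric] sum_distrib_left mult_ac)
    also have "\<dots> = (\<Prod>k=1..N t \<omega>. char step_law (\<theta> * c (\<lambda>s. N s \<omega>) k))"
      unfolding char_def
      by (rule expectation_prod_identically_distributed[OF Xs_indep]) (auto simp: Xs_copies)
    \<comment> \<open>The first grid point is 0, where \<open>N\<close> vanishes, and the last is
      \<open>t\<close>, so the cells account for all of \<open>{1..N t \<omega>}\<close>.\<close>
    also have "\<dots> = (\<Prod>i<Suc m. ?\<phi> i ^ (N (grid t m (Suc i)) \<omega> - N (grid t m i) \<omega>))"
      using prod_step_function[OF inc, where f="\<lambda>x. char step_law (\<theta> * x)" and m="Suc m"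
            and y="\<lambda>i. g (grid t m i)"] N_zero[OF \<omega>]
      by (simp only: grid_0 grid_last c_def)
    finally show "expectation (\<lambda>\<omega>'. iexp (\<theta> * S (process_path N \<omega>, seq_path Xs \<omega>'))) = \<dots>" .
  qed
  also have "\<dots> = (\<Prod>i<Suc m. expectation (\<lambda>\<omega>. ?\<phi> i ^ (N (grid t m (Suc i)) \<omega> - N (grid t m i) \<omega>)))"
  proof (rule indep_vars_lebesgue_integral)
    show "indep_vars (\<lambda>_. borel) (\<lambda>i \<omega>. ?\<phi> i ^ (N (grid t m (Suc i)) \<omega> - N (grid t m i) \<omega>)) {..<Suc m}"
      using t by (intro indep_vars_compose2[OF N_indep_increments[OF g0 grid_incseq]]) auto
    show "integrable P (\<lambda>\<omega>. ?\<phi> i ^ (N (grid t m (Suc i)) \<omega> - N (grid t m i) \<omega>))" for i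
    proof (rule integrable_const_bound[where B=1])
      have [measurable]: "N (grid t m j) \<in> P \<rightarrow>\<^sub>M count_space UNIV" for j
        by (rule N_measurable[OF g0])
      show "(\<lambda>\<omega>. ?\<phi> i ^ (N (grid t m (Suc i)) \<omega> - N (grid t m i) \<omega>)) \<in> borel_measurable P"
        by measurable
    qed (auto simp: norm_power intro!: power_le_one D.cmod_char_le_1)
  qed auto
  also have "\<dots> = (\<Prod>i<Suc m. exp (mean (grid t m i) (grid t m (Suc i)) * (?\<phi> i - 1)))"
    using t by (intro prod.cong refl expectation_power_increment g0 D.cmod_char_le_1 incseqD[OF grid_incseq]) auto
  also have "\<dots> = exp (\<Sum>i<Suc m. mean (grid t m i) (grid t m (Suc i)) * (?\<phi> i - 1))"
    by (simp only: exp_sum finite_lessThan)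
  finally show "expectation (\<lambda>\<omega>. iexp (\<theta> * Y m \<omega>)) = \<dots>" .
qed

text \<open>The grid is refined: the rounded sums converge pointwise, so their characteristic
  functions converge by dominated convergence, while the exponents converge as Riemann-Stieltjes
  sums. Continuity of \<open>g\<close> enters in both limits.\<close>

lemma
  fixes g :: "real \<Rightarrow> real"
  assumes t: "0 < t" and g: "continuous_on UNIV g"
  defines "Y \<equiv> \<lambda>\<omega>. \<Sum>k=1..N t \<omega>. Xs k \<omega> * g (arrival k \<omega>)"
  shows measurable_arrival_sum: "Y \<in> borel_measurable P"
    and char_arrival_sum: "char (distr P borel Y) \<theta>
      = exp (\<integral>s. (indicator {0..t} s * rate s) *\<^sub>R (char step_law (\<theta> * g s) - 1) \<partial>lborel)"
proof -
  interpret D: real_distribution step_law by (rule real_distribution_step_law)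
  define Ym where "Ym m \<omega> = (\<Sum>k=1..N t \<omega>. Xs k \<omega> * grid_step t m g (arrival k \<omega>))" for m \<omega>
  have Ym[measurable]: "Ym m \<in> borel_measurable P" for m
    unfolding Ym_def[abs_def] by (rule measurable_grid_step_sum[OF t])
  have lim: "(\<lambda>m. Ym m \<omega>) \<longlonglongrightarrow> Y \<omega>" if \<omega>: "\<omega> \<in> space P" for \<omega>
    unfolding Ym_def Y_def
  proof (intro tendsto_sum tendsto_mult_left grid_step_tendsto[OF t _ _ g])
    fix k assume k: "k \<in> {1..N t \<omega>}"
    show "0 < arrival k \<omega>" using arrival_pos[OF \<omega>, of t k] k t by auto
    show "arrival k \<omega> \<le> t" using arrival_le_iff[OF \<omega>, of t k t] k t by auto
  qed
  show Y[measurable]: "Y \<in> borel_measurable P"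
    by (rule borel_measurable_LIMSEQ_real[OF lim Ym])
  have "(\<lambda>m. expectation (\<lambda>\<omega>. iexp (\<theta> * Ym m \<omega>))) \<longlonglongrightarrow> expectation (\<lambda>\<omega>. iexp (\<theta> * Y \<omega>))"
    by (rule integral_dominated_convergence[where w="\<lambda>_. 1"])
       (auto intro!: tendsto_intros lim)
  moreover have "(\<lambda>m. expectation (\<lambda>\<omega>. iexp (\<theta> * Ym m \<omega>)))
      \<longlonglongrightarrow> exp (\<integral>s. (indicator {0..t} s * rate s) *\<^sub>R (char step_law (\<theta> * g s) - 1) \<partial>lborel)"
    unfolding Ym_def char_grid_step_sum[OF t]
  \<comment> \<open>The bound 2 is the triangle inequality for a characteristic function minus
    1.\<close>
  proof (intro tendsto_exp sum_mean_grid_tendsto[OF t, where C=2])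
    have "continuous_on UNIV (char step_law)"
      by (auto intro!: continuous_at_imp_continuous_on D.isCont_char)
    then have "continuous_on UNIV (\<lambda>s. char step_law (\<theta> * g s))"
      by (rule continuous_on_compose2) (auto intro!: continuous_intros g)
    then show "continuous_on UNIV (\<lambda>s. char step_law (\<theta> * g s) - 1)"
      by (intro continuous_intros)
    show "norm (char step_law (\<theta> * g s) - 1) \<le> 2" for s
      using norm_triangle_ineq4[of "char step_law (\<theta> * g s)" 1] D.cmod_char_le_1[of "\<theta> * g s"] by simp
  qed
  ultimately show "char (distr P borel Y) \<theta>
      = exp (\<integral>s. (indicator {0..t} s * rate s) *\<^sub>R (char step_law (\<theta> * g s) - 1) \<partial>lborel)"
    by (auto simp: char_def integral_distr intro: LIMSEQ_unique)
qed

end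

section \<open>The sum with independent marks, and equality of laws\<close>

context compound_poisson_process
begin

text \<open>As the marks are independent of the jumps, each jump contributes the same factor, the
  average of \<open>char step_law (\<theta> * g s)\<close> over the mark law. Only the count
  \<open>N t\<close> then remains random, and one Poisson generating function finishes.\<close>

lemma
  fixes g :: "real \<Rightarrow> real"
  assumes t: "0 < t" and g: "g \<in> borel_measurable borel"
    and V: "indep_vars (\<lambda>_. borel) V {1..}" "\<And>k. 1 \<le> k \<Longrightarrow> distr P borel (V k) = L"
    and ind: "indep_elements (nat_process_space \<Otimes>\<^sub>M real_seq_space)
      (\<lambda>\<omega>. (process_path N \<omega>, seq_path Xs \<omega>)) real_seq_space (seq_path V)"
  defines "Z \<equiv> \<lambda>\<omega>. \<Sum>k=1..N t \<omega>. Xs k \<omega> * g (V k \<omega>)"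
  shows measurable_marked_sum: "Z \<in> borel_measurable P"
    and char_marked_sum: "char (distr P borel Z) \<theta>
      = exp (mean 0 t * ((\<integral>s. char step_law (\<theta> * g s) \<partial>L) - 1))"
proof -
  note g[measurable]
  interpret D: real_distribution step_law by (rule real_distribution_step_law)
  have V1[measurable]: "V k \<in> borel_measurable P" if "1 \<le> k" for k
    using V(1) that by (auto simp: indep_vars_def)
  have L: "L = distr P borel (V 1)" using V(2)[of 1] by simp
  have setsL[measurable_cong]: "sets L = sets borel" by (simp add: L)
  interpret L: prob_space L unfolding L by (rule prob_space_distr) simp
  interpret DL: pair_prob_space step_law L ..
  have [measurable]: "N t \<in> P \<rightarrow>\<^sub>M count_space UNIV" using t by (intro N_measurable) auto
  have XV: "(\<lambda>\<omega>. Xs k \<omega> * g (V k \<omega>)) \<in> borel_measurable P" if "1 \<le> k" for k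
    using that Xs_measurable[of k] by measurable
  show Z[measurable]: "Z \<in> borel_measurable P"
    unfolding Z_def
    by (rule measurable_compose_countable[where g="N t"]) (auto intro!: borel_measurable_sum XV)

  \<comment> \<open>The sum as a measurable function of the three paths, the form that
    \<open>indep_elements_expectation\<close> requires.\<close>
  define S1 where "S1 q = (\<Sum>k=1..fst (fst q) t. snd (fst q) k * g (snd q k))"
    for q :: "((real \<Rightarrow> nat) \<times> (nat \<Rightarrow> real)) \<times> (nat \<Rightarrow> real)"
  let ?NX = "nat_process_space \<Otimes>\<^sub>M real_seq_space"
  have fst_t[measurable]: "(\<lambda>p. fst p t) \<in> ?NX \<rightarrow>\<^sub>M count_space UNIV"
    using t by (intro measurable_compose[OF measurable_fst] measurable_component_singleton) auto
  have snd_k[measurable]: "(\<lambda>p. snd p k) \<in> borel_measurable ?NX" if "1 \<le> k" for k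
    using that by (intro measurable_compose[OF measurable_snd] measurable_component_singleton) auto
  have l_k: "(\<lambda>l. l k) \<in> borel_measurable real_seq_space" if "1 \<le> k" for k
    using that by (intro measurable_component_singleton) auto
  have S1[measurable]: "S1 \<in> borel_measurable (?NX \<Otimes>\<^sub>M real_seq_space)"
  proof -
    have [measurable]: "(\<lambda>q. snd (fst q) k) \<in> borel_measurable (?NX \<Otimes>\<^sub>M real_seq_space)"
      "(\<lambda>q. snd q k) \<in> borel_measurable (?NX \<Otimes>\<^sub>M real_seq_space)" if "1 \<le> k" for k
      by (rule measurable_compose[OF measurable_fst snd_k[OF that]])
         (rule measurable_compose[OF measurable_snd l_k[OF that]])
    have t': "(\<lambda>q. fst (fst q) t) \<in> ?NX \<Otimes>\<^sub>M real_seq_space \<rightarrow>\<^sub>M count_space UNIV"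
      by (rule measurable_compose[OF measurable_fst fst_t])
    have "(\<lambda>q. \<Sum>k=1..n. snd (fst q) k * g (snd q k)) \<in> borel_measurable (?NX \<Otimes>\<^sub>M real_seq_space)" for n
      by (intro borel_measurable_sum) simp
    then have "(\<lambda>q. \<Sum>k=1..fst (fst q) t. snd (fst q) k * g (snd q k)) \<in> borel_measurable (?NX \<Otimes>\<^sub>M real_seq_space)"
      by (rule measurable_compose_countable[OF _ t'])
    then show ?thesis unfolding S1_def[abs_def] .
  qed
  have iexp_S1: "(\<lambda>q. iexp (\<theta> * S1 q)) \<in> borel_measurable (?NX \<Otimes>\<^sub>M real_seq_space)"
    by measurable
  have S1_path: "S1 ((process_path N \<omega>, seq_path Xs \<omega>), seq_path V \<omega>') = (\<Sum>k=1..N t \<omega>. Xs k \<omega> * g (V k \<omega>'))" for \<omega> \<omega>'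
    using t by (auto simp: S1_def process_path_def seq_path_def intro!: sum.cong)

  \<comment> \<open>\<open>\<psi> x\<close> is the factor of one jump of size \<open>x\<close> after
    its mark has been averaged out.\<close>
  define \<psi> where "\<psi> x = (\<integral>s. iexp (\<theta> * x * g s) \<partial>L)" for x
  have \<psi>[measurable]: "\<psi> \<in> borel_measurable borel"
    unfolding \<psi>_def by (rule L.borel_measurable_lebesgue_integral) measurable
  have \<psi>_le: "norm (\<psi> x) \<le> 1" for x
    unfolding \<psi>_def by (rule L.norm_expectation_le) auto
  \<comment> \<open>Exchanging the two averages puts the step size inside, where its integral is a
    characteristic function.\<close>
  have \<psi>_int: "(\<integral>x. \<psi> x \<partial>step_law) = (\<integral>s. char step_law (\<theta> * g s) \<partial>L)"
  proof -
    have "(\<integral>s. (\<integral>x. iexp (\<theta> * x * g s) \<partial>step_law) \<partial>L) = (\<integral>x. \<psi> x \<partial>step_law)"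
      unfolding \<psi>_def
      by (rule DL.Fubini_integral, rule DL.P.integrable_const_bound[where B=1])
         (simp_all add: case_prod_beta)
    then show ?thesis by (simp add: char_def mult_ac)
  qed

  define S2 where "S2 p = (\<Prod>k=1..fst p t. \<psi> (snd p k))"
    for p :: "(real \<Rightarrow> nat) \<times> (nat \<Rightarrow> real)"
  have S2[measurable]: "S2 \<in> borel_measurable ?NX"
  proof -
    have "(\<lambda>p. \<Prod>k=1..n. \<psi> (snd p k)) \<in> borel_measurable ?NX" for n
      by (intro borel_measurable_prod) simp
    then have "(\<lambda>p. \<Prod>k=1..fst p t. \<psi> (snd p k)) \<in> borel_measurable ?NX"
      by (rule measurable_compose_countable[OF _ fst_t])
    then show ?thesis unfolding S2_def[abs_def] .
  qed
  have S2_path: "S2 (process_path N \<omega>, seq_path Xs \<omega>') = (\<Prod>k=1..N t \<omega>. \<psi> (Xs k \<omega>'))" for \<omega> \<omega>'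
    using t by (auto simp: S2_def process_path_def seq_path_def intro!: prod.cong)

  \<comment> \<open>Integrate out the marks \<open>V\<close>, then the step sizes, and finally \<open>N t\<close>.\<close>
  have "char (distr P borel Z) \<theta> = expectation (\<lambda>\<omega>. iexp (\<theta> * S1 ((process_path N \<omega>, seq_path Xs \<omega>), seq_path V \<omega>)))"
    unfolding char_def S1_path by (subst integral_distr) (simp_all add: Z_def[abs_def, symmetric], simp add: Z_def)
  also have "\<dots> = expectation (\<lambda>\<omega>. expectation (\<lambda>\<omega>'. iexp (\<theta> * S1 ((process_path N \<omega>, seq_path Xs \<omega>), seq_path V \<omega>'))))"
    by (rule indep_elements_expectation[OF ind iexp_S1, where B=1]) simp
  also have "\<dots> = expectation (\<lambda>\<omega>. S2 (process_path N \<omega>, seq_path Xs \<omega>))"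
  proof (intro Bochner_Integration.integral_cong refl)
    fix \<omega>
    have "expectation (\<lambda>\<omega>'. iexp (\<theta> * S1 ((process_path N \<omega>, seq_path Xs \<omega>), seq_path V \<omega>')))
        = expectation (\<lambda>\<omega>'. \<Prod>k=1..N t \<omega>. iexp (\<theta> * Xs k \<omega> * g (V k \<omega>')))"
      unfolding S1_path by (simp add: exp_sum[symmetric] sum_distrib_left mult_ac)
    also have "\<dots> = (\<Prod>k=1..N t \<omega>. \<psi> (Xs k \<omega>))"
      unfolding \<psi>_def
      by (rule expectation_prod_identically_distributed[OF V]) auto
    finally show "expectation (\<lambda>\<omega>'. iexp (\<theta> * S1 ((process_path N \<omega>, seq_path Xs \<omega>), seq_path V \<omega>')))
        = S2 (process_path N \<omega>, seq_path Xs \<omega>)"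
      by (simp add: S2_path)
  qed
  also have "\<dots> = expectation (\<lambda>\<omega>. expectation (\<lambda>\<omega>'. S2 (process_path N \<omega>, seq_path Xs \<omega>')))"
  proof (rule indep_elements_expectation[OF N_Xs_indep S2, where B=1])
    have "norm (\<Prod>k\<in>K. \<psi> (x k)) \<le> 1" for K :: "nat set" and x
      by (auto simp: prod_norm[symmetric] intro!: prod_le_1 \<psi>_le)
    then show "norm (S2 p) \<le> 1" for p
      by (simp add: S2_def)
  qed
  \<comment> \<open>As \<open>N 0\<close> is 0, the exponent can be written as an increment, to
    which \<open>expectation_power_increment\<close> applies.\<close>
  also have "\<dots> = expectation (\<lambda>\<omega>. (\<integral>x. \<psi> x \<partial>step_law) ^ (N t \<omega> - N 0 \<omega>))"
  proof (intro Bochner_Integration.integral_cong refl)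
    fix \<omega> assume \<omega>: "\<omega> \<in> space P"
    have "expectation (\<lambda>\<omega>'. \<Prod>k=1..N t \<omega>. \<psi> (Xs k \<omega>')) = (\<Prod>k=1..N t \<omega>. (\<integral>x. \<psi> x \<partial>step_law))"
      by (rule expectation_prod_identically_distributed[OF Xs_indep]) (auto simp: Xs_copies \<psi>_le)
    then show "expectation (\<lambda>\<omega>'. S2 (process_path N \<omega>, seq_path Xs \<omega>'))
        = (\<integral>x. \<psi> x \<partial>step_law) ^ (N t \<omega> - N 0 \<omega>)"
      by (simp add: S2_path N_zero[OF \<omega>])
  qed
  also have "\<dots> = exp (mean 0 t * ((\<integral>s. char step_law (\<theta> * g s) \<partial>L) - 1))"
    using t D.norm_expectation_le[of \<psi> 1] \<psi>_le
    unfolding \<psi>_int[symmetric] by (intro expectation_power_increment) auto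
  finally show "char (distr P borel Z) \<theta> = \<dots>" .
qed

text \<open>The marks have density \<open>rate\<close> divided by \<open>mean 0 t\<close> on
  \<open>{0..t}\<close>, so multiplying their integral by \<open>mean 0 t\<close> recovers the
  exponent found for the jump times. Equal characteristic functions then give equal laws by Levy's
  uniqueness theorem.\<close>

lemma arrival_sum_eq_marked_sum_in_distribution:
  fixes g :: "real \<Rightarrow> real"
  assumes t: "0 < t" and mean_pos: "0 < mean 0 t" and g: "continuous_on UNIV g"
    and V: "indep_vars (\<lambda>_. borel) V {1..}"
      "\<And>k. 1 \<le> k \<Longrightarrow> distributed P lborel (V k) (\<lambda>s. ennreal (indicator {0..t} s * rate s / mean 0 t))"
    and ind: "indep_elements (nat_process_space \<Otimes>\<^sub>M real_seq_space)
      (\<lambda>\<omega>. (process_path N \<omega>, seq_path Xs \<omega>)) real_seq_space (seq_path V)"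
  shows "eq_in_distribution P (\<lambda>\<omega>. \<Sum>k=1..N t \<omega>. Xs k \<omega> * g (arrival k \<omega>))
    (\<lambda>\<omega>. \<Sum>k=1..N t \<omega>. Xs k \<omega> * g (V k \<omega>))"
proof -
  define f where "f s = indicator {0..t} s * rate s" for s
  define L where "L = density lborel (\<lambda>s. ennreal (f s / mean 0 t))"
  interpret D: real_distribution step_law by (rule real_distribution_step_law)
  have f: "integrable lborel f"
    using rate_integrable[of t] t by (simp add: set_integrable_def f_def[abs_def])
  then have [measurable]: "f \<in> borel_measurable borel" by auto
  have f0: "0 \<le> f s" for s using rate_nonneg by (auto simp: f_def indicator_def)
  have mean: "mean 0 t = (\<integral>s. f s \<partial>lborel)"
    by (simp add: mean_def set_lebesgue_integral_def f_def)
  have gb: "g \<in> borel_measurable borel" by (rule borel_measurable_continuous_onI[OF g])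
  have VL: "distr P borel (V k) = L" if "1 \<le> k" for k
  proof -
    have "distr P borel (V k) = distr P lborel (V k)" by (rule distr_cong) auto
    then show ?thesis
      using distributed_distr_eq_density[OF V(2)[OF that]] by (simp add: L_def f_def)
  qed
  note Y = measurable_arrival_sum[OF t g] and Z = measurable_marked_sum[OF t gb V(1) VL ind]
  have "char (distr P borel (\<lambda>\<omega>. \<Sum>k=1..N t \<omega>. Xs k \<omega> * g (arrival k \<omega>)))
    = char (distr P borel (\<lambda>\<omega>. \<Sum>k=1..N t \<omega>. Xs k \<omega> * g (V k \<omega>)))"
  proof
    fix \<theta>
    define h where "h s = char step_law (\<theta> * g s)" for s
    have "continuous_on UNIV (char step_law)"
      by (auto intro!: continuous_at_imp_continuous_on D.isCont_char)
    then have "continuous_on UNIV h"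
      unfolding h_def by (rule continuous_on_compose2) (auto intro!: continuous_intros g)
    then have [measurable]: "h \<in> borel_measurable borel" by (rule borel_measurable_continuous_onI)
    have fh: "integrable lborel (\<lambda>s. f s *\<^sub>R h s)"
    proof (rule Bochner_Integration.integrable_bound[OF f])
      show "AE s in lborel. norm (f s *\<^sub>R h s) \<le> norm (f s)"
        using D.cmod_char_le_1 by (auto simp: h_def f0 intro!: mult_left_le)
    qed simp
    have "(\<integral>s. h s \<partial>L) = (\<integral>s. (f s / mean 0 t) *\<^sub>R h s \<partial>lborel)"
      unfolding L_def using mean_pos by (intro integral_density) (auto simp: f0)
    also have "\<dots> = (\<integral>s. (1 / mean 0 t) *\<^sub>R (f s *\<^sub>R h s) \<partial>lborel)"
      by (intro Bochner_Integration.integral_cong) simp_all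
    also have "\<dots> = (1 / mean 0 t) *\<^sub>R (\<integral>s. f s *\<^sub>R h s \<partial>lborel)"
      by (rule integral_scaleR_right)
    \<comment> \<open>The normalising constant cancels; the remaining \<open>mean 0 t\<close> is the
      integral of \<open>f\<close> and supplies the \<open>- 1\<close> under the integral.\<close>
    finally have "mean 0 t * ((\<integral>s. h s \<partial>L) - 1) = (\<integral>s. f s *\<^sub>R h s \<partial>lborel) - mean 0 t"
      using mean_pos by (simp add: scaleR_conv_of_real field_simps)
    also have "\<dots> = (\<integral>s. f s *\<^sub>R h s - complex_of_real (f s) \<partial>lborel)"
      unfolding mean using fh f by (subst Bochner_Integration.integral_diff) auto
    also have "\<dots> = (\<integral>s. f s *\<^sub>R (h s - 1) \<partial>lborel)"
      by (simp add: scaleR_conv_of_real algebra_simps)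
    finally show "char (distr P borel (\<lambda>\<omega>. \<Sum>k=1..N t \<omega>. Xs k \<omega> * g (arrival k \<omega>))) \<theta>
      = char (distr P borel (\<lambda>\<omega>. \<Sum>k=1..N t \<omega>. Xs k \<omega> * g (V k \<omega>))) \<theta>"
      by (subst char_arrival_sum[OF t g], subst char_marked_sum[OF t gb V(1) VL ind])
         (simp_all only: h_def f_def)
  qed
  with Y Z show ?thesis
    unfolding eq_in_distribution_def
    by (auto intro!: Levy_uniqueness real_distribution_distr)
qed

section \<open>\<open>M\<close> as a step function, and its integrals\<close>

text \<open>Summing up to \<open>N t\<close> makes the index set independent of \<open>s\<close>:
  for each outcome, the path on \<open>{0..t}\<close> is a fixed finite combination of unit
  steps.\<close>

lemma M_eq_arrival_sum:
  assumes t: "0 < t" and \<omega>: "\<omega> \<in> space P" and s: "0 \<le> s" "s \<le> t"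
  shows "M s \<omega> = (\<Sum>k=1..N t \<omega>. Xs k \<omega> * (if arrival k \<omega> \<le> s then 1 else 0))"
proof -
  have "N s \<omega> \<le> N t \<omega>" using N_mono[OF \<omega>] s by (auto simp: mono_on_def)
  then have "{1..N s \<omega>} = {k \<in> {1..N t \<omega>}. arrival k \<omega> \<le> s}"
    using arrival_le_iff[OF \<omega> _ _ s(1), of t] t by auto
  then show ?thesis
    unfolding M_eq[OF s(1) \<omega>] by (simp add: sum.If_cases Int_def if_distrib cong: if_cong)
qed

end

text \<open>The power \<open>(u - T) ^ n\<close> occurs in the iterated integral and
  \<open>(s - u) ^ n\<close> in the single one. That both give the same value is why the two
  integrals of \<open>M\<close> agree.\<close>

lemma set_integral_polynomial_from:
  fixes T s :: real
  assumes T: "0 \<le> T"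
  shows "(LINT u:{0..s}|lborel. if T \<le> u then (u - T) ^ n else 0)
      = (if T \<le> s then (s - T) ^ Suc n / Suc n else 0)"
    and "set_integrable lborel {0..s} (\<lambda>u. if T \<le> u then (u - T) ^ n else 0)"
    and "(LINT u:{0..s}|lborel. if T \<le> u then (s - u) ^ n else 0)
      = (if T \<le> s then (s - T) ^ Suc n / Suc n else 0)"
    and "set_integrable lborel {0..s} (\<lambda>u. if T \<le> u then (s - u) ^ n else 0)"
proof -
  \<comment> \<open>As \<open>T\<close> is nonnegative, the condition \<open>T \<le> u\<close>
    shrinks \<open>{0..s}\<close> to \<open>{T..s}\<close>, which is empty if
    \<open>s < T\<close>.\<close>
  have eq: "indicat_real {0..s} u *\<^sub>R (if T \<le> u then p u else 0) = p u * indicat_real {T..s} u" for p :: "real \<Rightarrow> real" and u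
    using T by (auto simp: indicator_def)
  note eq1 = eq[of _ "\<lambda>u. (u - T) ^ n"] and eq2 = eq[of _ "\<lambda>u. (s - u) ^ n"]
  have D1: "((\<lambda>u. (u - T) ^ Suc n / Suc n) has_real_derivative (u - T) ^ n) (at u)"
    and D2: "((\<lambda>u. - ((s - u) ^ Suc n) / Suc n) has_real_derivative (s - u) ^ n) (at u)" for u
    by (rule derivative_eq_intros refl | simp)+
  have i: "(\<integral>u. (u - T) ^ n * indicat_real {T..s} u \<partial>lborel) = (s - T) ^ Suc n / Suc n"
      "(\<integral>u. (s - u) ^ n * indicat_real {T..s} u \<partial>lborel) = (s - T) ^ Suc n / Suc n" if "T \<le> s"
  proof -
    have "(\<integral>u. (u - T) ^ n * indicat_real {T..s} u \<partial>lborel) = (s - T) ^ Suc n / Suc n - (T - T) ^ Suc n / Suc n"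
      by (rule integral_FTC_Icc_real[OF that D1]) (auto intro!: continuous_intros)
    then show "(\<integral>u. (u - T) ^ n * indicat_real {T..s} u \<partial>lborel) = (s - T) ^ Suc n / Suc n" by simp
    have "(\<integral>u. (s - u) ^ n * indicat_real {T..s} u \<partial>lborel) = - ((s - s) ^ Suc n) / Suc n - - ((s - T) ^ Suc n) / Suc n"
      by (rule integral_FTC_Icc_real[OF that D2]) (auto intro!: continuous_intros)
    then show "(\<integral>u. (s - u) ^ n * indicat_real {T..s} u \<partial>lborel) = (s - T) ^ Suc n / Suc n" by simp
  qed
  show "(LINT u:{0..s}|lborel. if T \<le> u then (u - T) ^ n else 0)
      = (if T \<le> s then (s - T) ^ Suc n / Suc n else 0)"
    "(LINT u:{0..s}|lborel. if T \<le> u then (s - u) ^ n else 0)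
      = (if T \<le> s then (s - T) ^ Suc n / Suc n else 0)"
    unfolding set_lebesgue_integral_def eq1 eq2 using i by auto
  have int: "integrable lborel (\<lambda>u. p u * indicat_real {T..s} u)" if "continuous_on {T..s} p" for p :: "real \<Rightarrow> real"
    using borel_integrable_atLeastAtMost'[OF that] by (simp add: set_integrable_def mult.commute)
  show "set_integrable lborel {0..s} (\<lambda>u. if T \<le> u then (u - T) ^ n else 0)"
    "set_integrable lborel {0..s} (\<lambda>u. if T \<le> u then (s - u) ^ n else 0)"
    unfolding set_integrable_def eq1 eq2 by (intro int continuous_intros)+
qed

lemma set_integral_sum_mult:
  fixes p :: "'i \<Rightarrow> 'c \<Rightarrow> real"
  assumes "\<And>k. k \<in> K \<Longrightarrow> set_integrable M A (p k)"
  shows "(LINT u:A|M. \<Sum>k\<in>K. x k * p k u) = (\<Sum>k\<in>K. x k * (LINT u:A|M. p k u))"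
proof -
  have "(LINT u:A|M. \<Sum>k\<in>K. x k * p k u) = (\<integral>u. (\<Sum>k\<in>K. x k * (indicator A u *\<^sub>R p k u)) \<partial>M)"
    by (simp add: set_lebesgue_integral_def sum_distrib_left mult_ac)
  also have "\<dots> = (\<Sum>k\<in>K. x k * (\<integral>u. indicator A u *\<^sub>R p k u \<partial>M))"
    using assms unfolding set_integrable_def
    by (subst Bochner_Integration.integral_sum) auto
  finally show ?thesis by (simp add: set_lebesgue_integral_def)
qed

text \<open>By induction: each integration raises the power of \<open>s - T k\<close> by one and
  divides by the new exponent, which builds up \<open>fact n\<close>.\<close>

lemma iterated_integral_step_function:
  fixes T x :: "'i \<Rightarrow> real"
  assumes T: "\<And>k. k \<in> K \<Longrightarrow> 0 \<le> T k"
    and f: "\<And>s. 0 \<le> s \<Longrightarrow> s \<le> t \<Longrightarrow> f s = (\<Sum>k\<in>K. x k * (if T k \<le> s then 1 else 0))"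
    and s: "0 \<le> s" "s \<le> t"
  shows "iterated_integral n f s = (\<Sum>k\<in>K. x k / fact n * (if T k \<le> s then (s - T k) ^ n else 0))"
  using s
proof (induction n arbitrary: s)
  \<comment> \<open>The convention \<open>0 ^ 0 = 1\<close> gives the right value 1 at
    \<open>s = T k\<close>.\<close>
  case 0
  then show ?case by (simp add: f if_distrib cong: if_cong)
next
  case (Suc n)
  have "iterated_integral (Suc n) f s
      = (LINT u:{0..s}|lborel. \<Sum>k\<in>K. x k / fact n * (if T k \<le> u then (u - T k) ^ n else 0))"
    unfolding iterated_integral.simps using Suc by (intro set_lebesgue_integral_cong) auto
  also have "\<dots> = (\<Sum>k\<in>K. x k / fact n * (if T k \<le> s then (s - T k) ^ Suc n / Suc n else 0))"
    using T by (subst set_integral_sum_mult) (auto simp: set_integral_polynomial_from)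
  finally show ?case by (auto intro!: sum.cong)
qed

lemma set_integral_step_function_mult_power:
  fixes T x :: "'i \<Rightarrow> real"
  assumes T: "\<And>k. k \<in> K \<Longrightarrow> 0 \<le> T k"
    and f: "\<And>s. 0 \<le> s \<Longrightarrow> s \<le> t \<Longrightarrow> f s = (\<Sum>k\<in>K. x k * (if T k \<le> s then 1 else 0))"
  shows "(LINT s:{0..t}|lborel. f s * (t - s) ^ n) = (\<Sum>k\<in>K. x k * (if T k \<le> t then (t - T k) ^ Suc n / Suc n else 0))"
proof -
  have "(LINT s:{0..t}|lborel. f s * (t - s) ^ n)
      = (LINT s:{0..t}|lborel. \<Sum>k\<in>K. x k * (if T k \<le> s then (t - s) ^ n else 0))"
    by (intro set_lebesgue_integral_cong) (auto simp: f sum_distrib_right intro!: sum.cong)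
  then show ?thesis
    using T by (simp add: set_integral_sum_mult set_integral_polynomial_from)
qed

section \<open>Convergence in probability and conclusion\<close>

text \<open>For each outcome the indicator of the deviation event is eventually 0, so its
  expectation tends to 0 by dominated convergence.\<close>

lemma (in prob_space) pointwise_imp_converges_in_probability:
  assumes Z[measurable]: "\<And>n. Z n \<in> borel_measurable M" and Y[measurable]: "Y \<in> borel_measurable M"
    and lim: "\<And>\<omega>. \<omega> \<in> space M \<Longrightarrow> (\<lambda>n. Z n \<omega>) \<longlonglongrightarrow> Y \<omega>"
  shows "converges_in_probability M Z Y"
  unfolding converges_in_probability_def
proof (intro allI impI)
  fix \<epsilon> :: real assume \<epsilon>: "0 < \<epsilon>"
  have "(\<lambda>n. \<integral>\<omega>. indicator {\<omega> \<in> space M. \<bar>Z n \<omega> - Y \<omega>\<bar> > \<epsilon>} \<omega> \<partial>M) \<longlonglongrightarrow> (\<integral>\<omega>. (0 :: real) \<partial>M)"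
  proof (rule integral_dominated_convergence[where w="\<lambda>_. 1"])
    show "AE \<omega> in M. (\<lambda>n. indicat_real {\<omega> \<in> space M. \<bar>Z n \<omega> - Y \<omega>\<bar> > \<epsilon>} \<omega>) \<longlonglongrightarrow> 0"
    proof (rule AE_I2)
      fix \<omega> assume "\<omega> \<in> space M"
      from tendstoD[OF lim[OF this] \<epsilon>] have "\<forall>\<^sub>F n in sequentially. indicat_real {\<omega> \<in> space M. \<bar>Z n \<omega> - Y \<omega>\<bar> > \<epsilon>} \<omega> = 0"
        by eventually_elim (auto simp: dist_real_def)
      then show "(\<lambda>n. indicat_real {\<omega> \<in> space M. \<bar>Z n \<omega> - Y \<omega>\<bar> > \<epsilon>} \<omega>) \<longlonglongrightarrow> 0"
        by (rule tendsto_eventually)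
    qed
  qed (auto simp: indicator_def)
  then show "(\<lambda>n. prob {\<omega> \<in> space M. \<bar>Z n \<omega> - Y \<omega>\<bar> > \<epsilon>}) \<longlonglongrightarrow> 0"
    by (simp add: Int_absorb2 subset_eq)
qed

theorem mainTheorem10:
  fixes P :: "'a measure" and Q :: "'b measure"
    and rate :: "real \<Rightarrow> real"
    and N :: "real \<Rightarrow> 'a \<Rightarrow> nat"
    and X :: "'b \<Rightarrow> real"
    and Xs :: "nat \<Rightarrow> 'a \<Rightarrow> real"
    and M :: "real \<Rightarrow> 'a \<Rightarrow> real"
    and t :: real
    and \<Lambda> :: "nat \<Rightarrow> 'a \<Rightarrow> real"
  assumes "continuous_on {0..} rate"
    and "\<And>s. 0 \<le> s \<Longrightarrow> 0 \<le> rate s"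
    and "\<And>s. 0 \<le> s \<Longrightarrow> set_integrable lborel {0..s} rate"
    and "compound_poisson_process P rate N Q X Xs M"
    and "t > 0"
    and "(LINT u:{0..t}|lborel. rate u) > 0"
    and "prob_space.indep_vars P (\<lambda>_. borel) \<Lambda> {1..}"
    and "\<And>k. 1 \<le> k \<Longrightarrow> distributed P lborel (\<Lambda> k)
          (\<lambda>s. ennreal (indicator {0..t} s * rate s / (LINT u:{0..t}|lborel. rate u)))"
    and "prob_space.indep_elements P
          (nat_process_space \<Otimes>\<^sub>M real_seq_space) (\<lambda>\<omega>. (process_path N \<omega>, seq_path Xs \<omega>))
          real_seq_space (seq_path \<Lambda>)"
  shows "(\<forall>n\<ge>1.
            (\<forall>\<omega>\<in>space P. iterated_integral n (\<lambda>s. M s \<omega>) t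
               = 1 / fact (n - 1) * (LINT s:{0..t}|lborel. M s \<omega> * (t - s) ^ (n - 1)))
          \<and> eq_in_distribution P
              (\<lambda>\<omega>. 1 / fact (n - 1) * (LINT s:{0..t}|lborel. M s \<omega> * (t - s) ^ (n - 1)))
              (\<lambda>\<omega>. t ^ n / fact n * (\<Sum>k=1..N t \<omega>. Xs k \<omega> * (1 - \<Lambda> k \<omega> / t) ^ n)))
      \<and> converges_in_probability P
          (\<lambda>n \<omega>. t ^ n / fact n * (\<Sum>k=1..N t \<omega>. Xs k \<omega> * (1 - \<Lambda> k \<omega> / t) ^ n))
          (\<lambda>_. 0)"
proof -
  interpret compound_poisson_process P rate N Q X Xs M by (fact assms(4))
  have t: "0 < t" by (fact assms(5))
  note ind = assms(9)
  have rep: "M s \<omega> = (\<Sum>k=1..N t \<omega>. Xs k \<omega> * (if arrival k \<omega> \<le> s then 1 else 0))"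
    if "\<omega> \<in> space P" "0 \<le> s" "s \<le> t" for \<omega> s
    using M_eq_arrival_sum[OF t that] .
  have arrival: "0 \<le> arrival k \<omega>" "arrival k \<omega> \<le> t" if "\<omega> \<in> space P" "k \<in> {1..N t \<omega>}" for k \<omega>
    using arrival_pos[of \<omega> t k] arrival_le_iff[of \<omega> t k t] that t by auto
  have iterated: "iterated_integral n (\<lambda>s. M s \<omega>) t = (\<Sum>k=1..N t \<omega>. Xs k \<omega> * ((t - arrival k \<omega>) ^ n / fact n))"
    if \<omega>: "\<omega> \<in> space P" for n \<omega>
    by (subst iterated_integral_step_function[OF arrival(1)[OF \<omega>] rep[OF \<omega>]])
       (use t arrival(2)[OF \<omega>] in \<open>auto intro!: sum.cong\<close>)
  have single: "1 / fact (n - 1) * (LINT s:{0..t}|lborel. M s \<omega> * (t - s) ^ (n - 1))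
      = (\<Sum>k=1..N t \<omega>. Xs k \<omega> * ((t - arrival k \<omega>) ^ n / fact n))"
    if \<omega>: "\<omega> \<in> space P" and n: "1 \<le> n" for n \<omega>
  proof -
    \<comment> \<open>For positive \<open>n\<close> the truncated \<open>n - 1\<close> is a true
      predecessor, and \<open>1 / fact m\<close> times \<open>1 / Suc m\<close> is
      \<open>1 / fact n\<close>.\<close>
    obtain m where m: "n = Suc m" using n by (cases n) auto
    show ?thesis
      unfolding m diff_Suc_1
      by (subst set_integral_step_function_mult_power[OF arrival(1)[OF \<omega>] rep[OF \<omega>]])
         (use arrival(2)[OF \<omega>] in \<open>auto simp: sum_distrib_left intro!: sum.cong\<close>)
  qed
  \<comment> \<open>Moving \<open>t ^ n\<close> into the power exhibits the same function of the
    marks that is evaluated at the jump times above.\<close>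
  have scaled: "t ^ n / fact n * (\<Sum>k=1..N t \<omega>. Xs k \<omega> * (1 - \<Lambda> k \<omega> / t) ^ n)
      = (\<Sum>k=1..N t \<omega>. Xs k \<omega> * ((t - \<Lambda> k \<omega>) ^ n / fact n))" for n \<omega>
  proof -
    have "(t - l) ^ n = t ^ n * (1 - l / t) ^ n" for l
      using t by (simp add: power_mult_distrib[symmetric] right_diff_distrib)
    then show ?thesis by (simp add: sum_distrib_left mult_ac)
  qed
  have law: "eq_in_distribution P
      (\<lambda>\<omega>. \<Sum>k=1..N t \<omega>. Xs k \<omega> * ((t - arrival k \<omega>) ^ n / fact n))
      (\<lambda>\<omega>. \<Sum>k=1..N t \<omega>. Xs k \<omega> * ((t - \<Lambda> k \<omega>) ^ n / fact n))" for n
    by (rule arrival_sum_eq_marked_sum_in_distribution[OF t _ _ assms(7) _ ind, where g="\<lambda>s. (t - s) ^ n / fact n"])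
       (use assms(6,8) in \<open>auto simp: mean_def intro!: continuous_intros\<close>)
  have "converges_in_probability P (\<lambda>n \<omega>. \<Sum>k=1..N t \<omega>. Xs k \<omega> * ((t - \<Lambda> k \<omega>) ^ n / fact n)) (\<lambda>_. 0)"
  proof (rule pointwise_imp_converges_in_probability)
    show "(\<lambda>\<omega>. \<Sum>k=1..N t \<omega>. Xs k \<omega> * ((t - \<Lambda> k \<omega>) ^ n / fact n)) \<in> borel_measurable P" for n
      using law[of n] by (simp add: eq_in_distribution_def)
    \<comment> \<open>For a fixed outcome there are finitely many summands, each a constant times a
      term of an exponential series.\<close>
    show "(\<lambda>n. \<Sum>k=1..N t \<omega>. Xs k \<omega> * ((t - \<Lambda> k \<omega>) ^ n / fact n)) \<longlonglongrightarrow> 0" for \<omega>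
      using summable_LIMSEQ_zero[OF summable_exp]
      by (intro tendsto_null_sum tendsto_mult_right_zero) (simp add: divide_inverse mult.commute)
  qed simp
  moreover have "eq_in_distribution P
      (\<lambda>\<omega>. 1 / fact (n - 1) * (LINT s:{0..t}|lborel. M s \<omega> * (t - s) ^ (n - 1)))
      (\<lambda>\<omega>. \<Sum>k=1..N t \<omega>. Xs k \<omega> * ((t - \<Lambda> k \<omega>) ^ n / fact n))" if "1 \<le> n" for n
    using law[of n] single[OF _ that]
    by (simp add: eq_in_distribution_def cong: measurable_cong distr_cong)
  ultimately show ?thesis
    unfolding scaled by (auto simp only: iterated single)
qed

end
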